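(* Every graph $G$ with at least one vertex satisfies $\operatorname{vol}(G)\le 2^{\lceil\log_2\operatorname{mag}(G)\rceil}<2\operatorname{mag}(G)$.
   Context: Graphs are finite, simple and undirected. An injection $f:V(G)\to\mathbb{Z}^+$ is antimagic if $f(v)+f(w)\neq f(x)+f(y)$ for all distinct edges $vw,xy\in E(G)$. With $[k]=\{1,\dots,k\}$, $\operatorname{mag}(G)$ is the minimum $k$ such that $G$ has an antimagic injection $V(G)\to[k]$. Given an injection $\lambda:V(G)\to\{0,1\}^d$, for each edge $vw$ let $\lambda(vw)$ be the open line segment in $\mathbb{R}^d$ with endpoints $\lambda(v),\lambda(w)$. Two distinct edges cross if their open segments intersect. $\lambda$ is a $d$-dimensional hypercube drawing of $G$ if no two distinct edges cross; its volume is $2^d$. $\operatorname{vol}(G)$ is the minimum volume of a hypercube drawing of $G$ (over all integers $d\ge0$). *)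

theory Defs
  imports Complex_Main "Jordan_Normal_Form.Matrix"
begin

definition simple_graph :: "'a set \<Rightarrow> 'a set set \<Rightarrow> bool" where
  "simple_graph V E \<longleftrightarrow> finite V \<and> (\<forall>e\<in>E. e \<subseteq> V \<and> card e = 2)"

definition antimagic_injection :: "'a set \<Rightarrow> 'a set set \<Rightarrow> ('a \<Rightarrow> nat) \<Rightarrow> bool" where
  "antimagic_injection V E f \<longleftrightarrow>
     inj_on f V \<and> (\<forall>v\<in>V. f v > 0) \<and>
     (\<forall>v w x y. {v, w} \<in> E \<longrightarrow> {x, y} \<in> E \<longrightarrow> {v, w} \<noteq> {x, y} \<longrightarrow> f v + f w \<noteq> f x + f y)"

definition mag :: "'a set \<Rightarrow> 'a set set \<Rightarrow> nat" where
  "mag V E = (LEAST k. \<exists>f. antimagic_injection V E f \<and> f ` V \<subseteq> {1..k})"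

text \<open>Since the dimension varies, points of the $d$-dimensional real space are elements of
  \<open>carrier_vec d\<close>; this type is not a real vector space in the sense of the type class, so
  \<open>open_segment\<close> from the analysis library is not available.  The definition below is only used
  for distinct end points.\<close>

definition open_vec_segment :: "real vec \<Rightarrow> real vec \<Rightarrow> real vec set" where
  "open_vec_segment a b = {(1 - t) \<cdot>\<^sub>v a + t \<cdot>\<^sub>v b | t. 0 < t \<and> t < 1}"

definition hypercube_vertices :: "nat \<Rightarrow> real vec set" where
  "hypercube_vertices d = {x \<in> carrier_vec d. \<forall>i<d. x $ i \<in> {0, 1}}"

definition hypercube_drawing :: "nat \<Rightarrow> 'a set \<Rightarrow> 'a set set \<Rightarrow> ('a \<Rightarrow> real vec) \<Rightarrow> bool" where
  "hypercube_drawing d V E l \<longleftrightarrow>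
     inj_on l V \<and> l ` V \<subseteq> hypercube_vertices d \<and>
     (\<forall>v w x y. {v, w} \<in> E \<longrightarrow> {x, y} \<in> E \<longrightarrow> {v, w} \<noteq> {x, y} \<longrightarrow>
        open_vec_segment (l v) (l w) \<inter> open_vec_segment (l x) (l y) = {})"

definition vol :: "'a set \<Rightarrow> 'a set set \<Rightarrow> nat" where
  "vol V E = (LEAST n. \<exists>d l. hypercube_drawing d V E l \<and> n = 2 ^ d)"

end

(* Map each vertex v to the binary expansion of f v - 1, where f is an optimal antimagic injection.
   A point of an open segment between two hypercube vertices has a coordinate equal to 0 (or 1)
   exactly where both end points have it, so crossing edges have end points with the same
   coordinatewise sum, hence with the same sum of f-values. *)
theory Submission
  imports Defs "HOL-Library.Nat_Bijection"
begin

text \<open>As 0 < t < 1, the combination of a and b is 0, 1 or strictly in between according as a +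
  b is 0, 2 or 1. Its value thus determines a + b, even when t and s differ.\<close>

lemma convex_combination_bits_eq:
  fixes a b c e s t :: real
  assumes "a \<in> {0, 1}" "b \<in> {0, 1}" "c \<in> {0, 1}" "e \<in> {0, 1}"
    and "0 < t" "t < 1" "0 < s" "s < 1"
    and "(1 - t) * a + t * b = (1 - s) * c + s * e"
  shows "a + b = c + e"
  using assms by (elim insertE emptyE) simp_all

lemma crossing_segments_sum_eq:
  assumes vertices: "{a, b, c, e} \<subseteq> hypercube_vertices d"
    and crossing: "open_vec_segment a b \<inter> open_vec_segment c e \<noteq> {}"
    and i: "i < d"
  shows "a $ i + b $ i = c $ i + e $ i"
proof -
  obtain s t where st: "0 < t" "t < 1" "0 < s" "s < 1"
    and eq: "(1 - t) \<cdot>\<^sub>v a + t \<cdot>\<^sub>v b = (1 - s) \<cdot>\<^sub>v c + s \<cdot>\<^sub>v e"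
    using crossing unfolding open_vec_segment_def by blast
  have dims: "dim_vec a = d" "dim_vec b = d" "dim_vec c = d" "dim_vec e = d"
    and bits: "a $ i \<in> {0, 1}" "b $ i \<in> {0, 1}" "c $ i \<in> {0, 1}" "e $ i \<in> {0, 1}"
    using vertices i unfolding hypercube_vertices_def by auto
  have "((1 - t) \<cdot>\<^sub>v a + t \<cdot>\<^sub>v b) $ i = ((1 - s) \<cdot>\<^sub>v c + s \<cdot>\<^sub>v e) $ i"
    using eq by simp
  then have "(1 - t) * a $ i + t * b $ i = (1 - s) * c $ i + s * e $ i"
    using dims i by simp
  then show ?thesis by (rule convex_combination_bits_eq[OF bits st])
qed

definition binary_vec :: "nat \<Rightarrow> nat \<Rightarrow> real vec" where
  "binary_vec d n = vec d (\<lambda>i. of_bool (i \<in> set_decode n))"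

lemma binary_vec_in_hypercube_vertices: "binary_vec d n \<in> hypercube_vertices d"
  unfolding binary_vec_def hypercube_vertices_def by auto

text \<open>Bits at positions d and above would be cut off by \<open>binary_vec\<close>; the bound
  on n excludes them. This linear functional later turns coordinatewise equality of vector sums into
  equality of sums of labels.\<close>

lemma sum_binary_vec:
  assumes "n < 2 ^ d"
  shows "(\<Sum>i<d. 2 ^ i * binary_vec d n $ i) = real n"
proof -
  have "i < d" if "i \<in> set_decode n" for i
  proof (rule ccontr)
    assume "\<not> i < d"
    then have "n < 2 ^ i"
      using assms by (meson less_le_trans not_less one_le_numeral power_increasing)
    \<comment> \<open>Membership means that \<open>n div 2 ^ i\<close> is odd, but for n < 2 ^ i
      this quotient is 0.\<close>
    with that show False by (simp add: set_decode_def)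
  qed
  then have sub: "set_decode n \<subseteq> {..<d}" by blast
  have "(\<Sum>i<d. 2 ^ i * binary_vec d n $ i) = (\<Sum>i<d. if i \<in> set_decode n then 2 ^ i else 0)"
    by (rule sum.cong) (auto simp: binary_vec_def)
  also have "\<dots> = (\<Sum>i\<in>set_decode n. 2 ^ i)"
    using sub by (simp add: sum.If_cases Int_absorb1)
  also have "\<dots> = real (set_encode (set_decode n))"
    unfolding set_encode_def by simp
  finally show ?thesis by simp
qed

lemma edge_subset:
  assumes "simple_graph V E" "{v, w} \<in> E"
  shows "v \<in> V" "w \<in> V" "v \<noteq> w"
  using assms unfolding simple_graph_def by fastforce+

lemma hypercube_drawing_binary_vec:
  assumes graph: "simple_graph V E"
    and anti: "antimagic_injection V E f"
    and range: "f ` V \<subseteq> {1..2 ^ d}"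
  shows "hypercube_drawing d V E (\<lambda>v. binary_vec d (f v - 1))"
proof -
  define l where "l = (\<lambda>v. binary_vec d (f v - 1))"
  have vertex: "l v \<in> hypercube_vertices d" for v
    unfolding l_def by (rule binary_vec_in_hypercube_vertices)
  \<comment> \<open>Labels run from 1 to 2 ^ d, whereas d bits encode 0 to 2 ^ d - 1; hence the
    shift by one. As labels are positive, the natural subtraction loses nothing.\<close>
  have val: "(\<Sum>i<d. 2 ^ i * l v $ i) = real (f v) - 1" if "v \<in> V" for v
  proof -
    have "1 \<le> f v" "f v \<le> 2 ^ d" using range that by auto
    then have "f v - 1 < 2 ^ d" by linarith
    then show ?thesis unfolding l_def using \<open>1 \<le> f v\<close> by (simp add: sum_binary_vec of_nat_diff)
  qed
  have "inj_on l V"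
  proof (rule inj_onI)
    fix v w assume vw: "v \<in> V" "w \<in> V" "l v = l w"
    then have "real (f v) = real (f w)" using val[of v] val[of w] by simp
    then show "v = w" using anti vw unfolding antimagic_injection_def inj_on_def by auto
  qed
  moreover have "open_vec_segment (l v) (l w) \<inter> open_vec_segment (l x) (l y) = {}"
    if e: "{v, w} \<in> E" "{x, y} \<in> E" "{v, w} \<noteq> {x, y}" for v w x y
  proof (rule ccontr)
    assume "open_vec_segment (l v) (l w) \<inter> open_vec_segment (l x) (l y) \<noteq> {}"
    then have eq: "l v $ i + l w $ i = l x $ i + l y $ i" if "i < d" for i
      using vertex that by (intro crossing_segments_sum_eq) auto
    have "(\<Sum>i<d. 2 ^ i * (l v $ i + l w $ i)) = (\<Sum>i<d. 2 ^ i * (l x $ i + l y $ i))"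
      using eq by (intro sum.cong) auto
    \<comment> \<open>By linearity each side is the label sum of an edge minus 2, so the shifts
      cancel.\<close>
    then have "real (f v) + real (f w) = real (f x) + real (f y)"
      using val edge_subset[OF graph e(1)] edge_subset[OF graph e(2)]
      by (simp add: distrib_left sum.distrib)
    then have "f v + f w = f x + f y" by linarith
    with e anti show False unfolding antimagic_injection_def by blast
  qed
  ultimately show ?thesis
    using vertex unfolding hypercube_drawing_def l_def[symmetric] by blast
qed

lemma vol_le:
  assumes "hypercube_drawing d V E l"
  shows "vol V E \<le> 2 ^ d"
  unfolding vol_def by (rule Least_le) (use assms in blast)

text \<open>Distinct powers of two serve as labels: the binary expansion of a sum of two different
  powers reveals both exponents.\<close>

lemma antimagic_injection_exists:
  assumes graph: "simple_graph V E"
  shows "\<exists>f. antimagic_injection V E f"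
proof -
  have "finite V" using graph unfolding simple_graph_def by blast
  then obtain g :: "'a \<Rightarrow> nat" where g: "inj_on g V"
    using finite_imp_inj_to_nat_seg by metis
  have "{v, w} = {x, y}"
    if e: "{v, w} \<in> E" "{x, y} \<in> E" and eq: "(2::nat) ^ g v + 2 ^ g w = 2 ^ g x + 2 ^ g y"
    for v w x y
  proof -
    note mem = edge_subset[OF graph e(1)] edge_subset[OF graph e(2)]
    \<comment> \<open>Different exponents make each sum the \<open>set_encode\<close> of a
      two-element set, and \<open>set_encode\<close> is injective on finite sets.\<close>
    have "g v \<noteq> g w" "g x \<noteq> g y" using g mem by (auto dest: inj_onD)
    then have "set_encode {g v, g w} = set_encode {g x, g y}"
      using eq by (simp add: set_encode_def)
    then have "g ` {v, w} = g ` {x, y}" by (simp add: set_encode_eq)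
    then show ?thesis using g mem by (subst (asm) inj_on_image_eq_iff) auto
  qed
  moreover have "inj_on (\<lambda>v. (2::nat) ^ g v) V"
    using g by (auto simp: inj_on_def)
  ultimately have "antimagic_injection V E (\<lambda>v. 2 ^ g v)"
    unfolding antimagic_injection_def by (intro conjI) (assumption | simp | blast)+
  then show ?thesis by blast
qed

text \<open>The \<open>LEAST\<close> in \<open>mag\<close> is attained once some bound k is
  admissible; the largest label of any antimagic injection is one.\<close>

lemma mag_attained:
  assumes graph: "simple_graph V E"
  obtains f where "antimagic_injection V E f" "f ` V \<subseteq> {1..mag V E}"
proof -
  obtain f where f: "antimagic_injection V E f"
    using antimagic_injection_exists[OF graph] ..
  have "finite V" using graph unfolding simple_graph_def by blast
  then have "f v \<le> Max (f ` V)" if "v \<in> V" for v using that by simp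
  \<comment> \<open>For empty V the value of \<open>Max\<close> is unspecified, but then the
    inclusion is trivial.\<close>
  then have "f ` V \<subseteq> {1..Max (f ` V)}"
    using f unfolding antimagic_injection_def by (auto simp: Suc_le_eq)
  with f have "\<exists>f. antimagic_injection V E f \<and> f ` V \<subseteq> {1..Max (f ` V)}" by blast
  with f \<open>f ` V \<subseteq> {1..Max (f ` V)}\<close>
  have "\<exists>k f. antimagic_injection V E f \<and> f ` V \<subseteq> {1..k}" by blast
  then have "\<exists>f. antimagic_injection V E f \<and> f ` V \<subseteq> {1..mag V E}"
    unfolding mag_def by (rule LeastI_ex)
  then show ?thesis using that by blast
qed

theorem lemma5:
  fixes V :: "'a set" and E :: "'a set set"
  assumes "simple_graph V E" and "V \<noteq> {}"
  shows "real (vol V E) \<le> 2 powi \<lceil>log 2 (real (mag V E))\<rceil> \<and>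
         (2 :: real) powi \<lceil>log 2 (real (mag V E))\<rceil> < 2 * real (mag V E)"
proof -
  obtain f where f: "antimagic_injection V E f" "f ` V \<subseteq> {1..mag V E}"
    using mag_attained[OF assms(1)] .
  define m where "m = mag V E"
  define d where "d = nat \<lceil>log 2 (real m)\<rceil>"
  \<comment> \<open>A vertex has its label in {1..m}, so m is positive. The logarithm is then
    nonnegative and \<open>nat\<close> in the definition of d does not truncate.\<close>
  have m: "1 \<le> m" using f(2) assms(2) unfolding m_def by fastforce
  then have log_nonneg: "0 \<le> log 2 (real m)" by simp
  then have d: "\<lceil>log 2 (real m)\<rceil> = int d" unfolding d_def by simp
  have "log 2 (real m) \<le> real d" "real d < log 2 (real m) + 1"
    using d by linarith+
  \<comment> \<open>Exponentiate the two ceiling bounds; the summand 1 becomes the factor 2 because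
    log 2 (2 * m) = log 2 m + 1.\<close>
  then have le: "real m \<le> 2 ^ d" and less: "2 ^ d < 2 * real m"
    using m log_le_iff[of 2 "real m" "real d"] less_log_iff[of 2 "2 * real m" "real d"]
    by (simp_all add: powr_realpow log_mult)
  have "m \<le> 2 ^ d" using le by (metis of_nat_le_iff of_nat_numeral of_nat_power)
  then have "f ` V \<subseteq> {1..2 ^ d}" using f(2) unfolding m_def by force
  then have "vol V E \<le> 2 ^ d"
    using hypercube_drawing_binary_vec[OF assms(1) f(1)] vol_le by blast
  then have "real (vol V E) \<le> 2 ^ d" by (metis of_nat_le_iff of_nat_numeral of_nat_power)
  with less show ?thesis unfolding m_def[symmetric] d by simp
qed

end
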